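(* For complex parameters $A=(A_0,A_1,A_2,A_3)$, the middle convolution with parameter $-\frac12$ sends $\tilde Z(A)$ to $L(A)$: $$mc_{-\frac12}\tilde Z(A)=L(A).$$
   Context: Let $\partial=d/dx$, $\theta=x\partial$. Middle convolution. For a differential operator $P=\sum p_{ij}x^i\partial^j$ with constant $p_{ij}$ and $\mu\in\mathbb{C}$, $mc_\mu P$ (symbolically $\partial^{-\mu}\circ P\circ\partial^{\mu}$) is defined as follows: put $r=\max\{i-j: p_{ij}\neq0\}$, multiply $P$ by $\partial^r$ from the left, use $x^i\partial^i=\theta(\theta-1)\cdots(\theta-i+1)$ to express $\partial^rP$ as a linear combination of $\theta^i\partial^j$, replace $\theta$ by $\theta-\mu$, and divide the result by $\partial$ from the left as many times as possible. The operator $\tilde Z(A)=x^2(x-1)^2\partial^4+m_1\partial^3+m_2\partial^2+m_3\partial+m_4$ has \begin{align*} m_1&=4(x-1)x(2x-1),\\ m_2&=\tfrac14\left(4A_0^2x-4A_0^2-4A_1^2x-4A_2^2x^2+4A_2^2x-4A_3^2x^2+4A_3^2x+58x^2-58x+9\right),\\ m_3&=\tfrac12\left(2A_0^2-2A_1^2-4A_2^2x+2A_2^2-4A_3^2x+2A_3^2+10x-5\right),\\ m_4&=(A_2-\tfrac12)(A_2+\tfrac12)(A_3-\tfrac12)(A_3+\tfrac12). \end{align*} The operator $L(A)=x^2(x-1)^2\partial^4+\ell_1\partial^3+\ell_2\partial^2+\ell_3\partial+\ell_4$ has \begin{align*} \ell_1&=5(x-1)x(2x-1),\\ \ell_2&=A_0^2x-A_0^2-A_1^2x-A_2^2x^2+A_2^2x-A_3^2x^2+A_3^2x+25x^2-25x+4,\\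 \ell_3&=-\tfrac32\left(-A_0^2+A_1^2+2A_2^2x-A_2^2+2A_3^2x-A_3^2-10x+5\right),\\ \ell_4&=(A_2-1)(A_2+1)(A_3-1)(A_3+1). \end{align*} For generic parameters it is, up to left multiplication by a function, $x^{-A_0}\circ K(A)\circ x^{A_0}$, where $K(A)$ is the tensor product (the fourth-order differential operator annihilating all products of solutions) of the two Gauss hypergeometric equations $E(A_{-+-+},A_{-++-};1-A_0)$ and $E(A_{----},A_{--++};1-A_0)$; here $E(\alpha,\beta;\gamma)=x(x-1)\partial^2+((\alpha+\beta+1)x-\gamma)\partial+\alpha\beta$ and $A_{\varepsilon_0\varepsilon_1\varepsilon_2\varepsilon_3}=(\varepsilon_0A_0+\varepsilon_1A_1+\varepsilon_2A_2+\varepsilon_3A_3+1)/2$ with $\varepsilon_j=\pm$.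
   Formalization: The identity is proved for A_2 and A_3 nonzero: if A_2 A_3 = 0, L(A) is left divisible by ∂, so it cannot equal the maximally divided mc_{-1/2} Z̃(A); for all complex A, the operator obtained before the final division by ∂ is shown to be L(A). *)

theory Defs
  imports Complex_Main "HOL-Computational_Algebra.Polynomial"
begin

section \<open>The Weyl algebra\<close>

text \<open>
  A differential operator \<open>P = \<Sum> p i j x^i \<partial>^j\<close> is stored as the polynomial in \<open>\<partial>\<close>
  whose coefficients, written to the left of the powers of \<open>\<partial>\<close>, are polynomials in \<open>x\<close>.
  The product below is composition of operators, not the commutative product of
  \<open>complex poly poly\<close>.
\<close>

typedef weyl = "UNIV :: complex poly poly set"
  morphisms normal_form of_normal_form by simp

setup_lifting type_definition_weyl

definition coeff_xd :: "weyl \<Rightarrow> nat \<Rightarrow> nat \<Rightarrow> complex" where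
  "coeff_xd P i j = coeff (coeff (normal_form P) j) i"

text \<open>\<open>\<partial> \<circ> \<Sum> a\<^sub>j \<partial>^j = \<Sum> a\<^sub>j' \<partial>^j + \<Sum> a\<^sub>j \<partial>^(j+1)\<close>, by the Leibniz rule.\<close>

definition d_comp :: "complex poly poly \<Rightarrow> complex poly poly" where
  "d_comp Q = map_poly pderiv Q + pCons 0 Q"

definition comp_nf :: "complex poly poly \<Rightarrow> complex poly poly \<Rightarrow> complex poly poly" where
  "comp_nf P Q = (\<Sum>j\<le>degree P. smult (coeff P j) ((d_comp ^^ j) Q))"

lemma map_pderiv_add: "map_poly pderiv (P + Q) = map_poly pderiv P + map_poly pderiv Q"
  for P Q :: "complex poly poly"
  by (intro poly_eqI) (simp add: coeff_map_poly pderiv_add)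

lemma map_pderiv_smult:
  "map_poly pderiv (smult a Q) = smult (pderiv a) Q + smult a (map_poly pderiv Q)"
  for Q :: "complex poly poly"
  by (intro poly_eqI) (simp add: coeff_map_poly pderiv_mult algebra_simps)

lemma d_comp_0 [simp]: "d_comp 0 = 0"
  by (simp add: d_comp_def)

lemma d_comp_add: "d_comp (P + Q) = d_comp P + d_comp Q"
  by (simp add: d_comp_def map_pderiv_add)

lemma d_comp_smult: "d_comp (smult a Q) = smult (pderiv a) Q + smult a (d_comp Q)"
  by (simp add: d_comp_def map_pderiv_smult smult_add_right)

lemma d_comp_pCons: "d_comp (pCons b Q) = pCons (pderiv b) ([:b:] + d_comp Q)"
proof -
  have "map_poly pderiv (pCons b Q) = pCons (pderiv b) (map_poly pderiv Q)"
    by (intro poly_eqI) (auto simp: coeff_map_poly coeff_pCons split: nat.split)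
  then have "d_comp (pCons b Q) = pCons (pderiv b) (map_poly pderiv Q + pCons b Q)"
    by (simp add: d_comp_def)
  also have "pCons b Q = [:b:] + pCons 0 Q" by simp
  finally show ?thesis by (simp add: d_comp_def algebra_simps)
qed

lemma d_comp_pow_0 [simp]: "(d_comp ^^ n) 0 = 0"
  by (induction n) auto

lemma d_comp_pow_add: "(d_comp ^^ n) (P + Q) = (d_comp ^^ n) P + (d_comp ^^ n) Q"
  by (induction n) (auto simp: d_comp_add)

lemma comp_nf_extend:
  "degree P \<le> n \<Longrightarrow> comp_nf P Q = (\<Sum>j\<le>n. smult (coeff P j) ((d_comp ^^ j) Q))"
  unfolding comp_nf_def by (rule sum.mono_neutral_left) (auto simp: coeff_eq_0)

lemma comp_nf_0_left [simp]: "comp_nf 0 Q = 0"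
  by (simp add: comp_nf_def)

lemma comp_nf_0_right [simp]: "comp_nf P 0 = 0"
  by (simp add: comp_nf_def)

lemma comp_nf_pCons: "comp_nf (pCons a P) Q = smult a Q + comp_nf P (d_comp Q)"
proof -
  have "comp_nf (pCons a P) Q =
      (\<Sum>j\<le>Suc (degree P). smult (coeff (pCons a P) j) ((d_comp ^^ j) Q))"
    by (rule comp_nf_extend) (simp add: degree_pCons_le)
  also have "\<dots> = smult a Q + comp_nf P (d_comp Q)"
    by (simp add: sum.atMost_Suc_shift comp_nf_def funpow_swap1 del: sum.atMost_Suc)
  finally show ?thesis .
qed

lemma comp_nf_add_left: "comp_nf (P + P') Q = comp_nf P Q + comp_nf P' Q"
proof -
  let ?n = "max (degree P) (degree P')"
  have "degree (P + P') \<le> ?n" by (rule degree_add_le_max)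
  then show ?thesis
    by (simp add: comp_nf_extend[of _ ?n] smult_add_left sum.distrib)
qed

lemma comp_nf_add_right: "comp_nf P (Q + Q') = comp_nf P Q + comp_nf P Q'"
  by (simp add: comp_nf_def d_comp_pow_add smult_add_right sum.distrib)

lemma comp_nf_smult_left: "comp_nf (smult a P) Q = smult a (comp_nf P Q)"
  by (induction P arbitrary: Q) (auto simp: comp_nf_pCons smult_add_right)

lemma comp_nf_d_comp: "comp_nf (d_comp Q) R = d_comp (comp_nf Q R)"
proof (induction Q arbitrary: R)
  case (pCons b Q)
  then show ?case
    by (simp add: d_comp_pCons comp_nf_pCons comp_nf_add_left d_comp_add d_comp_smult
        add.assoc)
qed simp

lemma comp_nf_assoc: "comp_nf (comp_nf P Q) R = comp_nf P (comp_nf Q R)"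
  by (induction P arbitrary: Q)
    (auto simp: comp_nf_pCons comp_nf_add_left comp_nf_smult_left comp_nf_d_comp)

lemma comp_nf_1_left [simp]: "comp_nf 1 Q = Q"
  by (simp add: comp_nf_def)

lemma d_comp_pow_1: "(d_comp ^^ j) 1 = monom 1 j"
  by (induction j)
    (auto simp: d_comp_def monom_Suc map_poly_monom[of pderiv] pderiv_1 one_pCons monom_0)

lemma comp_nf_1_right [simp]: "comp_nf P 1 = P"
  by (simp add: comp_nf_def d_comp_pow_1 smult_monom poly_as_sum_of_monoms)

instantiation weyl :: ring_1
begin

lift_definition zero_weyl :: weyl is 0 .
lift_definition one_weyl :: weyl is 1 .
lift_definition plus_weyl :: "weyl \<Rightarrow> weyl \<Rightarrow> weyl" is "(+)" .
lift_definition minus_weyl :: "weyl \<Rightarrow> weyl \<Rightarrow> weyl" is "(-)" .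
lift_definition uminus_weyl :: "weyl \<Rightarrow> weyl" is uminus .
lift_definition times_weyl :: "weyl \<Rightarrow> weyl \<Rightarrow> weyl" is comp_nf .

instance
proof
  fix a b c :: weyl
  show "a + b + c = a + (b + c)" by transfer (rule add.assoc)
  show "a + b = b + a" by transfer (rule add.commute)
  show "0 + a = a" by transfer simp
  show "- a + a = 0" by transfer simp
  show "a - b = a + - b" by transfer simp
  show "a * b * c = a * (b * c)" by transfer (rule comp_nf_assoc)
  show "1 * a = a" by transfer (rule comp_nf_1_left)
  show "a * 1 = a" by transfer (rule comp_nf_1_right)
  show "(a + b) * c = a * c + b * c" by transfer (rule comp_nf_add_left)
  show "a * (b + c) = a * b + a * c" by transfer (rule comp_nf_add_right)
  show "(0 :: weyl) \<noteq> 1" by transfer simp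
qed

end

lift_definition cst :: "complex \<Rightarrow> weyl" is "\<lambda>c. [:[:c:]:]" .
lift_definition X :: weyl is "[:[:0, 1:]:]" .
lift_definition D :: weyl is "[:0, 1:]" .

definition theta :: weyl where
  "theta = X * D"

text \<open>Operators act on polynomials, and the product is composition for this action.\<close>

definition act :: "weyl \<Rightarrow> complex poly \<Rightarrow> complex poly" where
  "act P f = (\<Sum>j\<le>degree (normal_form P). coeff (normal_form P) j * (pderiv ^^ j) f)"

lemma act_mult: "act (P * Q) f = act P (act Q f)"
proof -
  define a where "a P f = (\<Sum>j\<le>degree P. coeff P j * (pderiv ^^ j) f)"
    for P and f :: "complex poly"
  have ext: "a P f = (\<Sum>j\<le>n. coeff P j * (pderiv ^^ j) f)" if "degree P \<le> n" for P n f
    unfolding a_def using that by (intro sum.mono_neutral_left) (auto simp: coeff_eq_0)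
  have a0: "a 0 f = 0" for f by (simp add: a_def)
  have aC: "a (pCons c P) f = c * f + a P (pderiv f)" for c P f
  proof -
    have "a (pCons c P) f = (\<Sum>j\<le>Suc (degree P). coeff (pCons c P) j * (pderiv ^^ j) f)"
      by (rule ext) (simp add: degree_pCons_le)
    also have "\<dots> = c * f + a P (pderiv f)"
      by (simp add: sum.atMost_Suc_shift a_def funpow_swap1 del: sum.atMost_Suc)
    finally show ?thesis .
  qed
  have aA: "a (P + Q) f = a P f + a Q f" for P Q f
  proof -
    let ?n = "max (degree P) (degree Q)"
    have "degree (P + Q) \<le> ?n" by (rule degree_add_le_max)
    then show ?thesis by (simp add: ext[of _ ?n] algebra_simps sum.distrib)
  qed
  have aS: "a (smult c P) f = c * a P f" for c P f
    by (induction P arbitrary: f) (auto simp: a0 aC algebra_simps)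
  have aD: "a (d_comp Q) f = pderiv (a Q f)" for Q f
    by (induction Q arbitrary: f)
      (auto simp: a0 aC aA d_comp_pCons pderiv_add pderiv_mult algebra_simps)
  have "a (comp_nf P Q) f = a P (a Q f)" for P Q
    by (induction P arbitrary: Q) (auto simp: a0 aC aA aS aD comp_nf_pCons)
  then show ?thesis by (simp add: act_def a_def times_weyl.rep_eq)
qed

lemma normal_form_monomial:
  "normal_form (cst c * X ^ i * D ^ j) = monom (monom c i) j"
proof -
  have D: "normal_form (D ^ j) = monom 1 j"
  proof -
    have "normal_form (D ^ j) = (d_comp ^^ j) 1"
      by (induction j) (simp_all add: one_weyl.rep_eq times_weyl.rep_eq D.rep_eq comp_nf_pCons)
    then show ?thesis by (simp add: d_comp_pow_1)
  qed
  have X: "normal_form (X ^ i) = [:monom 1 i:]"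
    by (induction i)
      (simp_all add: one_weyl.rep_eq times_weyl.rep_eq X.rep_eq comp_nf_pCons one_pCons
        monom_0 monom_Suc)
  show ?thesis
    by (simp add: times_weyl.rep_eq cst.rep_eq D X comp_nf_pCons smult_monom)
qed

lemma eq_sum_monomials:
  "P = (\<Sum>j\<le>degree (normal_form P). \<Sum>i\<le>degree (coeff (normal_form P) j).
          cst (coeff_xd P i j) * X ^ i * D ^ j)" (is "P = ?S")
proof -
  have nf_sum: "normal_form (sum f A) = (\<Sum>a\<in>A. normal_form (f a))"
    for f :: "nat \<Rightarrow> weyl" and A
    by (induction A rule: infinite_finite_induct)
      (simp_all add: zero_weyl.rep_eq plus_weyl.rep_eq)
  have monom_sum: "(\<Sum>i\<in>A. monom (g i) j) = monom (\<Sum>i\<in>A. g i) j"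
    for g :: "nat \<Rightarrow> complex poly" and A :: "nat set" and j
    by (induction A rule: infinite_finite_induct) (simp_all add: add_monom[symmetric])
  have "normal_form ?S = normal_form P"
    by (simp add: nf_sum normal_form_monomial monom_sum coeff_xd_def poly_as_sum_of_monoms)
  then show ?thesis by (simp add: normal_form_inject)
qed


section \<open>Middle convolution\<close>

text \<open>
  \<open>theta_comb t Q\<close> is \<open>\<Sum> q i j t^i \<partial>^j\<close>, where \<open>q i j\<close> is the coefficient of the \<open>i\<close>-th power
  in the \<open>j\<close>-th coefficient of \<open>Q\<close>; replacing \<open>\<theta>\<close> by \<open>\<theta> - \<mu>\<close> means changing \<open>t\<close>.
\<close>

definition theta_comb :: "weyl \<Rightarrow> complex poly poly \<Rightarrow> weyl" where
  "theta_comb t Q =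
    (\<Sum>j\<le>degree Q. \<Sum>i\<le>degree (coeff Q j). cst (coeff (coeff Q j) i) * t ^ i * D ^ j)"

text \<open>The coefficients are unique; they exist if \<open>i \<le> j\<close> for all \<open>x^i \<partial>^j\<close> occurring in \<open>P\<close>.\<close>

definition theta_coeffs :: "weyl \<Rightarrow> complex poly poly" where
  "theta_coeffs P = (THE Q. theta_comb theta Q = P)"

definition excess :: "weyl \<Rightarrow> int" where
  "excess P = Max {int i - int j | i j. coeff_xd P i j \<noteq> 0}"

text \<open>
  Division by \<open>\<partial>\<close> from the left, repeated as often as possible. Since the Weyl algebra has no
  zero divisors, the quotient is unique for \<open>P \<noteq> 0\<close>; zero could be divided for ever.
\<close>

definition divide_D :: "weyl \<Rightarrow> weyl" where
  "divide_D P =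
    (if P = 0 then 0 else THE Q. (\<exists>k. P = D ^ k * Q) \<and> \<not> (\<exists>R. Q = D * R))"

text \<open>
  If \<open>excess P\<close> is negative, \<open>P\<close> is a combination of \<open>\<theta>^i \<partial>^j\<close> as it stands. Multiplying by
  \<open>\<partial>\<close> to the negative power \<open>excess P\<close> would only anticipate a part of the final division,
  so \<open>nat\<close> may truncate the exponent to \<open>0\<close>.
\<close>

definition mc_undivided :: "complex \<Rightarrow> weyl \<Rightarrow> weyl" where
  "mc_undivided \<mu> P =
    theta_comb (theta - cst \<mu>) (theta_coeffs (D ^ nat (excess P) * P))"

definition mc :: "complex \<Rightarrow> weyl \<Rightarrow> weyl" where
  "mc \<mu> P = divide_D (mc_undivided \<mu> P)"


section \<open>The two operators\<close>

definition Ztilde :: "complex \<Rightarrow> complex \<Rightarrow> complex \<Rightarrow> complex \<Rightarrow> weyl" where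
  "Ztilde A0 A1 A2 A3 =
    X^2 * (X - 1)^2 * D^4
    + 4 * (X - 1) * X * (2 * X - 1) * D^3
    + cst (1/4) * (cst (4 * A0^2) * X - cst (4 * A0^2) - cst (4 * A1^2) * X
        - cst (4 * A2^2) * X^2 + cst (4 * A2^2) * X - cst (4 * A3^2) * X^2
        + cst (4 * A3^2) * X + 58 * X^2 - 58 * X + 9) * D^2
    + cst (1/2) * (cst (2 * A0^2) - cst (2 * A1^2) - cst (4 * A2^2) * X + cst (2 * A2^2)
        - cst (4 * A3^2) * X + cst (2 * A3^2) + 10 * X - 5) * D
    + cst ((A2 - 1/2) * (A2 + 1/2) * (A3 - 1/2) * (A3 + 1/2))"

definition L :: "complex \<Rightarrow> complex \<Rightarrow> complex \<Rightarrow> complex \<Rightarrow> weyl" where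
  "L A0 A1 A2 A3 =
    X^2 * (X - 1)^2 * D^4
    + 5 * (X - 1) * X * (2 * X - 1) * D^3
    + (cst (A0^2) * X - cst (A0^2) - cst (A1^2) * X
        - cst (A2^2) * X^2 + cst (A2^2) * X - cst (A3^2) * X^2
        + cst (A3^2) * X + 25 * X^2 - 25 * X + 4) * D^2
    + cst (-(3/2)) * (cst (-(A0^2)) + cst (A1^2) + cst (2 * A2^2) * X - cst (A2^2)
        + cst (2 * A3^2) * X - cst (A3^2) - 10 * X + 5) * D
    + cst ((A2 - 1) * (A2 + 1) * (A3 - 1) * (A3 + 1))"

text \<open>
  \<open>L A0 A1 A2 A3\<close> is divisible by \<open>\<partial>\<close> from the left iff \<open>A2 * A3 = 0\<close>: its part of degree \<open>0\<close>
  is \<open>p(\<theta>)\<close> with \<open>p(-1) = A2^2 * A3^2\<close>, and \<open>D * R\<close> has a degree \<open>0\<close> part vanishing at \<open>-1\<close>.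
  An output of \<open>mc\<close> other than \<open>0\<close> is never divisible by \<open>\<partial>\<close>, so for those special parameters
  \<open>L\<close> can only be the middle convolution before the final division.
\<close>

end

theory Submission
  imports Defs
begin

text \<open>
  Sorted by degree, \<open>Ztilde = p0(\<theta>) + p1(\<theta>) \<partial> + p2(\<theta>) \<partial>^2\<close> with
  \<open>p0 = ((\<theta> + 1/2)^2 - A2^2) ((\<theta> + 1/2)^2 - A3^2)\<close>,
  \<open>p1 = (\<theta> + 1) (-2 \<theta>^2 - 4 \<theta> + A0^2 - A1^2 + A2^2 + A3^2 - 5/2)\<close> and
  \<open>p2 = (\<theta> + 3/2)^2 - A0^2\<close>; replacing \<open>\<theta>\<close> by \<open>\<theta> + 1/2\<close> gives \<open>L\<close>. Such an expansion is unique
  because \<open>\<theta>\<close> acts on \<open>x^n\<close> as multiplication by \<open>n\<close>. Finally, left multiples of \<open>\<partial>\<close> are killed by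
  the functional \<open>\<Sum> c i j x^i \<partial>^j \<mapsto> \<Sum> (-1)^i i! c i i\<close>, whose value on \<open>L\<close> is \<open>A2^2 A3^2\<close>.
\<close>

section \<open>Normal forms of sums and products\<close>

lemma normal_form_numeral: "normal_form (numeral n) = [:[:numeral n:]:]"
proof -
  have "normal_form (of_nat k) = of_nat k" for k
    by (induction k) (simp_all add: zero_weyl.rep_eq one_weyl.rep_eq plus_weyl.rep_eq)
  from this[of "numeral n"] show ?thesis by (simp add: numeral_poly)
qed

lemmas normal_form_simps =
  plus_weyl.rep_eq minus_weyl.rep_eq uminus_weyl.rep_eq times_weyl.rep_eq
  zero_weyl.rep_eq one_weyl.rep_eq cst.rep_eq X.rep_eq D.rep_eq normal_form_numeral

lemma cst_0 [simp]: "cst 0 = 0"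
  by transfer simp

text \<open>As D stands to the right of the coefficients, no Leibniz terms arise: D is
  \<open>d_comp 1\<close>, and the recursion for \<open>comp_nf\<close> moves it back into
  P.\<close>

lemma comp_nf_D_right: "comp_nf P [:0, 1:] = pCons 0 P"
proof -
  have "comp_nf P [:0, 1:] = comp_nf P (d_comp 1)"
    by (simp add: one_pCons d_comp_pCons pderiv_1)
  then show ?thesis using comp_nf_pCons[of 0 P 1] by simp
qed

lemma normal_form_mult_D: "normal_form (P * D) = pCons 0 (normal_form P)"
  by (simp add: times_weyl.rep_eq D.rep_eq comp_nf_D_right)

lemma cst_commute: "cst c * P = P * cst c"
proof transfer
  fix c :: complex and P :: "complex poly poly"
  have "comp_nf P [:[:c:]:] = smult [:c:] P"
  proof (induction P)
    case (pCons a P)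
    \<comment> \<open>Scalars have derivative 0, so c passes D; associativity then reduces to the
      induction hypothesis.\<close>
    have "d_comp [:[:c:]:] = comp_nf [:[:c:]:] [:0, 1:]"
      by (simp add: d_comp_pCons pderiv_pCons comp_nf_D_right)
    then have "comp_nf P (d_comp [:[:c:]:]) = pCons 0 (smult [:c:] P)"
      by (metis comp_nf_assoc comp_nf_D_right pCons.IH)
    then show ?case by (simp add: comp_nf_pCons mult.commute)
  qed simp
  then show "comp_nf [:[:c:]:] P = comp_nf P [:[:c:]:]" by (simp add: comp_nf_pCons)
qed

lemma normal_form_mult_D_power:
  "normal_form (P * D ^ n) = (pCons 0 ^^ n) (normal_form P)"
  by (induction n arbitrary: P)
    (simp_all add: normal_form_mult_D funpow_swap1 mult.assoc[symmetric])

lemma comp_nf_const_left: "comp_nf [:a:] Q = smult a Q"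
  by (simp add: comp_nf_pCons)

lemma map_pderiv_pCons: "map_poly pderiv (pCons b Q) = pCons (pderiv b) (map_poly pderiv Q)"
  for Q :: "complex poly poly"
  by (intro poly_eqI) (auto simp: coeff_map_poly coeff_pCons split: nat.split)

text \<open>The shift c lets one rule evaluate both expansions, with c = 0 for \<open>Ztilde\<close>
  and c = 1/2 for \<open>L\<close>.\<close>

lemma normal_form_shifted_theta_mult:
  "normal_form ((theta + cst c) * P) =
    smult [:c:] (normal_form P) +
    smult [:0, 1:] (pCons 0 (normal_form P) + map_poly pderiv (normal_form P))"
  by (simp add: theta_def normal_form_simps comp_nf_pCons d_comp_def add.commute)

lemma normal_form_D_mult: "normal_form (D * P) = d_comp (normal_form P)"
  by (simp add: normal_form_simps comp_nf_pCons)


section \<open>Expansions in powers of theta and D\<close>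

text \<open>The inner sum of \<open>theta_comb\<close>, split off so that both sums obey Horner
  recursions.\<close>

definition poly_weyl :: "weyl \<Rightarrow> complex poly \<Rightarrow> weyl" where
  "poly_weyl t p = (\<Sum>i\<le>degree p. cst (coeff p i) * t ^ i)"

lemma poly_weyl_0 [simp]: "poly_weyl t 0 = 0"
  by (simp add: poly_weyl_def)

lemma poly_weyl_pCons: "poly_weyl t (pCons c p) = cst c + t * poly_weyl t p"
proof -
  have "poly_weyl t (pCons c p) = (\<Sum>i\<le>Suc (degree p). cst (coeff (pCons c p) i) * t ^ i)"
    unfolding poly_weyl_def
    by (rule sum.mono_neutral_left) (auto simp: coeff_eq_0 degree_pCons_le)
  also have "\<dots> = cst c + (\<Sum>i\<le>degree p. cst (coeff p i) * t * t ^ i)"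
    by (simp add: sum.atMost_Suc_shift mult.assoc del: sum.atMost_Suc)
  also have "\<dots> = cst c + t * poly_weyl t p"
    by (simp add: poly_weyl_def sum_distrib_left cst_commute[of _ t] mult.assoc)
  finally show ?thesis .
qed

lemma theta_comb_0 [simp]: "theta_comb t 0 = 0"
  by (simp add: theta_comb_def)

lemma theta_comb_pCons: "theta_comb t (pCons p Q) = poly_weyl t p + theta_comb t Q * D"
proof -
  have eq: "theta_comb t Q = (\<Sum>j\<le>degree Q. poly_weyl t (coeff Q j) * D ^ j)" for Q
    by (simp add: theta_comb_def poly_weyl_def sum_distrib_right)
  have "theta_comb t (pCons p Q) =
      (\<Sum>j\<le>Suc (degree Q). poly_weyl t (coeff (pCons p Q) j) * D ^ j)"
    unfolding eq by (rule sum.mono_neutral_left) (auto simp: coeff_eq_0 degree_pCons_le)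
  also have "\<dots> = poly_weyl t p + (\<Sum>j\<le>degree Q. poly_weyl t (coeff Q j) * D ^ j * D)"
    by (simp add: sum.atMost_Suc_shift power_commutes mult.assoc del: sum.atMost_Suc)
  also have "\<dots> = poly_weyl t p + theta_comb t Q * D"
    by (simp add: eq sum_distrib_right)
  finally show ?thesis .
qed

section \<open>Action on monomials and uniqueness of expansions\<close>

lemma act_extend:
  "degree (normal_form P) \<le> n \<Longrightarrow>
    act P f = (\<Sum>j\<le>n. coeff (normal_form P) j * (pderiv ^^ j) f)"
  unfolding act_def by (rule sum.mono_neutral_left) (auto simp: coeff_eq_0)

lemma act_add: "act (P + Q) f = act P f + act Q f"
proof -
  let ?n = "max (degree (normal_form P)) (degree (normal_form Q))"
  have "degree (normal_form (P + Q)) \<le> ?n"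
    by (simp add: normal_form_simps degree_add_le_max)
  then show ?thesis
    by (simp add: act_extend[of _ ?n] normal_form_simps algebra_simps sum.distrib)
qed

lemma act_0 [simp]: "act 0 f = 0"
  by (simp add: act_def normal_form_simps)

lemma act_cst: "act (cst c) f = smult c f"
  by (simp add: act_def normal_form_simps)

lemma act_D: "act D f = pderiv f"
  by (simp add: act_def normal_form_simps)

lemma act_theta_monom: "act theta (monom c n) = monom (of_nat n * c) n"
proof -
  have "act X f = pCons 0 f" for f by (simp add: act_def normal_form_simps)
  then show ?thesis
    by (cases n) (simp_all add: theta_def act_mult act_D pderiv_monom monom_Suc[symmetric])
qed

lemma act_poly_weyl_theta: "act (poly_weyl theta p) (monom c n) = monom (poly p (of_nat n) * c) n"
proof (induction p)
  case (pCons a p)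
  then show ?case
    by (simp add: poly_weyl_pCons act_add act_mult act_cst act_theta_monom smult_monom add_monom
        algebra_simps)
qed simp

text \<open>\<open>theta\<close> preserves the degree of a monomial and D lowers it, so no higher
  power can appear.\<close>

lemma coeff_act_theta_comb_eq_0:
  "m < n \<Longrightarrow> coeff (act (theta_comb theta Q) (monom c m)) n = 0"
proof (induction Q arbitrary: c m)
  case (pCons p Q)
  then show ?case
    by (simp add: theta_comb_pCons act_add act_mult act_D act_poly_weyl_theta pderiv_monom)
qed simp

lemma theta_comb_theta_eq_0: "theta_comb theta Q = 0 \<Longrightarrow> Q = 0"
proof (induction Q)
  case (pCons p Q)
  \<comment> \<open>For n > 0 the derivative of x^n has degree n - 1 < n, so only the D-free part p
    contributes to the coefficient of x^n. Hence p has infinitely many roots.\<close>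
  have root: "poly p (of_nat n) = 0" if "n > 0" for n
  proof -
    have "0 = coeff (act (theta_comb theta (pCons p Q)) (monom 1 n)) n"
      using pCons.prems by simp
    also have "\<dots> = poly p (of_nat n)"
      using that by (simp add: theta_comb_pCons act_add act_mult act_D act_poly_weyl_theta
          pderiv_monom coeff_act_theta_comb_eq_0)
    finally show ?thesis by simp
  qed
  have "p = 0"
  proof (rule ccontr)
    assume "p \<noteq> 0"
    then have "finite {z. poly p z = 0}" by (rule poly_roots_finite)
    moreover have "of_nat ` {0<..} \<subseteq> {z. poly p z = 0}" using root by auto
    ultimately have "finite (of_nat ` {0<..} :: complex set)" by (rule rev_finite_subset)
    then have "finite {0::nat<..}" by (rule finite_imageD) (simp add: inj_on_def)
    then show False using infinite_Ioi by blast
  qed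
  moreover have "theta_comb theta Q = 0"
  proof -
    \<comment> \<open>Right multiplication by D only shifts the normal form, so D cancels.\<close>
    have "normal_form (theta_comb theta Q * D) = 0"
      using pCons.prems \<open>p = 0\<close> by (simp add: theta_comb_pCons normal_form_simps)
    then show ?thesis
      by (simp add: normal_form_mult_D normal_form_inject[symmetric] zero_weyl.rep_eq)
  qed
  ultimately show ?case using pCons.IH by simp
qed simp

lemma poly_weyl_add: "poly_weyl t (p + q) = poly_weyl t p + poly_weyl t q"
proof (induction p q rule: poly_induct2)
  case (pCons a p b q)
  moreover have "cst (a + b) = cst a + cst b" by transfer simp
  ultimately show ?case by (simp add: poly_weyl_pCons distrib_left add_ac)
qed simp

lemma theta_comb_add: "theta_comb t (P + Q) = theta_comb t P + theta_comb t Q"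
  by (induction P Q rule: poly_induct2)
    (simp_all add: theta_comb_pCons poly_weyl_add distrib_right add_ac)

lemma theta_coeffs_theta_comb: "theta_coeffs (theta_comb theta Q) = Q"
  unfolding theta_coeffs_def
proof (rule the_equality)
  fix Q' assume "theta_comb theta Q' = theta_comb theta Q"
  then have "Q' - Q = 0"
    using theta_comb_add[of theta Q "Q' - Q"] by (intro theta_comb_theta_eq_0) simp
  then show "Q' = Q" by simp
qed simp

lemma excess_eqI:
  assumes "\<And>i j. coeff_xd P i j \<noteq> 0 \<Longrightarrow> int i - int j \<le> e"
    and "coeff_xd P i j \<noteq> 0" "e = int i - int j"
  shows "excess P = e"
  unfolding excess_def
proof (rule Max_eqI)
  \<comment> \<open>\<open>Max\<close> needs a finite set; the degrees bound the support.\<close>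
  let ?I = "SIGMA j:{..degree (normal_form P)}. {..degree (coeff (normal_form P) j)}"
  have "{int i - int j | i j. coeff_xd P i j \<noteq> 0} \<subseteq> (\<lambda>(j, i). int i - int j) ` ?I"
  proof
    fix x assume "x \<in> {int i - int j | i j. coeff_xd P i j \<noteq> 0}"
    then obtain i j where x: "x = int i - int j" "coeff_xd P i j \<noteq> 0" by blast
    then have "coeff (normal_form P) j \<noteq> 0" by (auto simp: coeff_xd_def)
    with x have "(j, i) \<in> ?I" by (auto simp: coeff_xd_def intro: le_degree)
    with x show "x \<in> (\<lambda>(j, i). int i - int j) ` ?I" by force
  qed
  then show "finite {int i - int j | i j. coeff_xd P i j \<noteq> 0}"
    by (rule finite_subset) simp
qed (use assms in auto)


section \<open>Left divisibility by D\<close>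

lemma coeff_xd_D_mult:
  "coeff_xd (D * R) i j =
    of_nat (Suc i) * coeff_xd R (Suc i) j + (if j = 0 then 0 else coeff_xd R i (j - 1))"
  by (cases j)
    (simp_all add: coeff_xd_def normal_form_D_mult d_comp_def coeff_map_poly coeff_pderiv)

text \<open>The sum telescopes. The weight (-1)^i i! is the value at \<open>theta\<close> = -1 of
  \<open>theta\<close> (\<open>theta\<close> - 1) ... (\<open>theta\<close> - i + 1) = x^i
  D^i.\<close>

lemma alternating_sum_D_mult:
  "(\<Sum>i\<le>n. (-1) ^ i * fact i * coeff_xd (D * R) i i) =
    (-1) ^ n * fact (Suc n) * coeff_xd R (Suc n) n"
  by (induction n) (simp_all add: coeff_xd_D_mult algebra_simps)

lemma not_D_mult:
  assumes "\<And>i. i > n \<Longrightarrow> coeff_xd P i i = 0"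
    and "(\<Sum>i\<le>n. (-1) ^ i * fact i * coeff_xd P i i) \<noteq> 0"
  shows "P \<noteq> D * R"
proof
  assume P: "P = D * R"
  \<comment> \<open>N is beyond the order of R, so the telescoped boundary term vanishes; it is at
    least n, so only zero terms are added.\<close>
  define N where "N = max n (Suc (degree (normal_form R)))"
  have "(\<Sum>i\<le>n. (-1) ^ i * fact i * coeff_xd P i i) =
      (\<Sum>i\<le>N. (-1) ^ i * fact i * coeff_xd P i i)"
    by (rule sum.mono_neutral_left) (auto simp: assms(1) N_def)
  also have "\<dots> = (-1) ^ N * fact (Suc N) * coeff_xd R (Suc N) N"
    unfolding P by (rule alternating_sum_D_mult)
  also have "coeff_xd R (Suc N) N = 0"
    by (simp add: coeff_xd_def N_def coeff_eq_0)
  finally show False using assms(2) by simp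
qed

lemma divide_D_id:
  assumes "\<And>R. P \<noteq> D * R"
  shows "divide_D P = P"
proof -
  have "P \<noteq> 0" using assms[of 0] by simp
  moreover have "(THE Q. (\<exists>k. P = D ^ k * Q) \<and> \<not> (\<exists>R. Q = D * R)) = P"
  proof (rule the_equality)
    show "(\<exists>k. P = D ^ k * P) \<and> \<not> (\<exists>R. P = D * R)"
      using assms by (auto intro: exI[of _ 0])
    fix Q assume "(\<exists>k. P = D ^ k * Q) \<and> \<not> (\<exists>R. Q = D * R)"
    then obtain k where k: "P = D ^ k * Q" by blast
    \<comment> \<open>Any k > 0 would exhibit P as a left multiple of D.\<close>
    show "Q = P"
    proof (cases k)
      case (Suc l)
      then have "P = D * (D ^ l * Q)" using k by (simp add: mult.assoc)
      with assms show ?thesis by blast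
    qed (use k in simp)
  qed
  ultimately show ?thesis by (simp add: divide_D_def)
qed


section \<open>Expansions of the two operators\<close>

lemma normal_form_Ztilde:
  "normal_form (Ztilde A0 A1 A2 A3) =
    [: [:(A2^2 - 1/4) * (A3^2 - 1/4):],
       [:A0^2 - A1^2 + A2^2 + A3^2 - 5/2, 5 - 2 * A2^2 - 2 * A3^2:],
       [:9/4 - A0^2, A0^2 - A1^2 + A2^2 + A3^2 - 29/2, 29/2 - A2^2 - A3^2:],
       [:0, 4, -12, 8:],
       [:0, 0, 1, -2, 1:] :]"
  unfolding Ztilde_def power2_eq_square[of X] power2_eq_square[of "X - 1"]
    plus_weyl.rep_eq normal_form_mult_D normal_form_mult_D_power
  by (simp add: eval_nat_numeral normal_form_simps comp_nf_const_left one_pCons)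
    (simp add: field_simps power2_eq_square)

lemma normal_form_L:
  "normal_form (L A0 A1 A2 A3) =
    [: [:(A2^2 - 1) * (A3^2 - 1):],
       [:3/2 * (A0^2 - A1^2 + A2^2 + A3^2 - 5), 15 - 3 * A2^2 - 3 * A3^2:],
       [:4 - A0^2, A0^2 - A1^2 + A2^2 + A3^2 - 25, 25 - A2^2 - A3^2:],
       [:0, 5, -15, 10:],
       [:0, 0, 1, -2, 1:] :]"
  unfolding L_def power2_eq_square[of X] power2_eq_square[of "X - 1"]
    plus_weyl.rep_eq normal_form_mult_D normal_form_mult_D_power
  by (simp add: eval_nat_numeral normal_form_simps comp_nf_const_left one_pCons)
    (simp add: field_simps power2_eq_square)

text \<open>The rows are p0, p1, p2 expanded in powers of \<open>theta\<close>; p_k collects the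
  terms x^i D^(i+k).\<close>

definition Ztilde_theta :: "complex \<Rightarrow> complex \<Rightarrow> complex \<Rightarrow> complex \<Rightarrow> complex poly poly" where
  "Ztilde_theta A0 A1 A2 A3 =
    [: [:(A2^2 - 1/4) * (A3^2 - 1/4), 1/2 - A2^2 - A3^2, 3/2 - A2^2 - A3^2, 2, 1:],
       [:A0^2 - A1^2 + A2^2 + A3^2 - 5/2, A0^2 - A1^2 + A2^2 + A3^2 - 13/2, -6, -2:],
       [:9/4 - A0^2, 3, 1:] :]"

lemma theta_comb_Ztilde: "theta_comb theta (Ztilde_theta A0 A1 A2 A3) = Ztilde A0 A1 A2 A3"
proof -
  \<comment> \<open>Writing \<open>theta + cst 0\<close> makes the shifted product rule match;
    \<open>cst_0\<close> is therefore kept out of the simplifier.\<close>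
  have "normal_form (theta_comb (theta + cst 0) (Ztilde_theta A0 A1 A2 A3)) =
      normal_form (Ztilde A0 A1 A2 A3)"
    by (simp del: cst_0 add: Ztilde_theta_def theta_comb_pCons poly_weyl_pCons
        normal_form_shifted_theta_mult normal_form_mult_D plus_weyl.rep_eq zero_weyl.rep_eq cst.rep_eq
        map_pderiv_pCons pderiv_pCons normal_form_Ztilde)
  then show ?thesis by (simp add: normal_form_inject)
qed

lemma theta_comb_L:
  "theta_comb (theta - cst (-1/2)) (Ztilde_theta A0 A1 A2 A3) = L A0 A1 A2 A3"
proof -
  have "normal_form (theta_comb (theta + cst (1/2)) (Ztilde_theta A0 A1 A2 A3)) =
      normal_form (L A0 A1 A2 A3)"
    by (simp add: Ztilde_theta_def theta_comb_pCons poly_weyl_pCons normal_form_shifted_theta_mult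
        normal_form_mult_D plus_weyl.rep_eq zero_weyl.rep_eq cst.rep_eq
        map_pderiv_pCons pderiv_pCons normal_form_L)
      (simp add: field_simps power2_eq_square)
  moreover have "theta - cst (-1/2) = theta + cst (1/2)"
    by (simp add: normal_form_inject[symmetric] normal_form_simps)
  ultimately show ?thesis by (simp only: normal_form_inject)
qed

text \<open>Thus \<open>mc_undivided\<close> multiplies by D^0 and expands \<open>Ztilde\<close>
  itself. The leading term x^4 D^4 attains the maximum.\<close>

lemma excess_Ztilde: "excess (Ztilde A0 A1 A2 A3) = 0"
proof (rule excess_eqI)
  show "coeff_xd (Ztilde A0 A1 A2 A3) 4 4 \<noteq> 0"
    by (simp add: coeff_xd_def normal_form_Ztilde numeral_eq_Suc)
  fix i j assume "coeff_xd (Ztilde A0 A1 A2 A3) i j \<noteq> 0"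
  then show "int i - int j \<le> 0"
    by (auto simp: coeff_xd_def normal_form_Ztilde coeff_pCons split: nat.splits)
qed simp

theorem theorem5p2:
  fixes A0 A1 A2 A3 :: complex
  shows "(A2 \<noteq> 0 \<and> A3 \<noteq> 0 \<longrightarrow> mc (-1/2) (Ztilde A0 A1 A2 A3) = L A0 A1 A2 A3) \<and>
         mc_undivided (-1/2) (Ztilde A0 A1 A2 A3) = L A0 A1 A2 A3"
proof -
  have undivided: "mc_undivided (-1/2) (Ztilde A0 A1 A2 A3) = L A0 A1 A2 A3"
    unfolding mc_undivided_def excess_Ztilde
    by (simp add: theta_comb_Ztilde[symmetric] theta_coeffs_theta_comb theta_comb_L[simplified])
  have "divide_D (L A0 A1 A2 A3) = L A0 A1 A2 A3" if "A2 \<noteq> 0" "A3 \<noteq> 0"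
  proof (rule divide_D_id, rule not_D_mult)
    \<comment> \<open>The degree 0 part of \<open>L\<close> is ((\<open>theta\<close> + 1)^2 - A2^2)
      ((\<open>theta\<close> + 1)^2 - A3^2), evaluated here at \<open>theta\<close> = -1.\<close>
    have "(\<Sum>i\<le>4. (-1) ^ i * fact i * coeff_xd (L A0 A1 A2 A3) i i) = A2^2 * A3^2"
      by (simp add: coeff_xd_def normal_form_L numeral_eq_Suc algebra_simps)
    then show "(\<Sum>i\<le>4. (-1) ^ i * fact i * coeff_xd (L A0 A1 A2 A3) i i) \<noteq> 0"
      using that by simp
    fix i :: nat assume "i > 4"
    then show "coeff_xd (L A0 A1 A2 A3) i i = 0"
      by (simp add: coeff_xd_def normal_form_L coeff_pCons split: nat.split)
  qed
  then show ?thesis using undivided by (simp add: mc_def)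
qed

end
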